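(* Let $N\ge 2$ be an integer, let $\ell\in(0,\infty)$ and $a_1,\dots,a_N\in\mathbb{R}$, and let $X_1,\dots,X_N$ be independent random variables such that $X_i$ is uniformly distributed on $[a_i,a_i+\ell]$ for each $i$. Let $\nu_N(s)$ denote the (random) conditional continuity modulus of the sample mean given the fluctuations, as defined in the context. Then for any $s\in(0,\infty)$ and any $\delta\in(0,\ell]$, $$\mathbb{P}\{\nu_N(s)\ge \delta^{-1}s\}\le \frac{N\delta}{\ell}.$$ In particular, taking $\delta=s^{\alpha}$ (for $\alpha\in\mathbb{R}$ and $s\in(0,\infty)$ with $s^\alpha\le \ell$), $$\mathbb{P}\{\nu_N(s)\ge s^{1-\alpha}\}\le N\ell^{-1}s^{\alpha}.$$
   Context: Given random variables $X_1,\dots,X_N$, the sample mean is $\xi_N=\frac1N\sum_{i=1}^N X_i$ and the fluctuations are $\eta_i=X_i-\xi_N$, $i=1,\dots,N$. Let $\mathfrak{F}_\eta$ be the sigma-algebra generated by $\eta_1,\dots,\eta_N$. The conditional continuity modulus is the $\mathfrak{F}_\eta$-measurable random variable $$\nu_N(s)=\sup_{t\in\mathbb{R}}\mathbb{P}\{\xi_N\in[t,t+s]\mid \mathfrak{F}_\eta\},\qquad s\in(0,\infty),$$ where the conditional probabilities are computed from a regular conditional distribution of $\xi_N$ given $\mathfrak{F}_\eta$ (so $\nu_N(s)$ is defined up to almost sure equality). *)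

theory Defs
  imports "HOL-Probability.Probability"
begin

definition sample_mean :: "nat \<Rightarrow> (nat \<Rightarrow> 'a \<Rightarrow> real) \<Rightarrow> 'a \<Rightarrow> real" where
  "sample_mean N X \<omega> = (\<Sum>i=1..N. X i \<omega>) / real N"

definition fluctuation :: "nat \<Rightarrow> (nat \<Rightarrow> 'a \<Rightarrow> real) \<Rightarrow> nat \<Rightarrow> 'a \<Rightarrow> real" where
  "fluctuation N X i \<omega> = X i \<omega> - sample_mean N X \<omega>"

text \<open>Only the underlying \<open>\<sigma>\<close>-algebra of the following measure is relevant.\<close>

definition fluctuation_algebra :: "'a measure \<Rightarrow> nat \<Rightarrow> (nat \<Rightarrow> 'a \<Rightarrow> real) \<Rightarrow> 'a measure" where
  "fluctuation_algebra M N X =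
     sigma (space M) {fluctuation N X i -` A \<inter> space M |i A. i \<in> {1..N} \<and> A \<in> sets borel}"

text \<open>\<open>\<kappa>\<close> is a regular conditional distribution of the real random variable \<open>Y\<close> given the
  sub-\<open>\<sigma>\<close>-algebra \<open>F\<close>: an \<open>F\<close>-measurable family of Borel probability measures such that
  \<open>\<kappa> \<omega> A\<close> is, for each Borel set \<open>A\<close>, a version of the conditional probability of
  \<open>Y \<in> A\<close> given \<open>F\<close>.\<close>

definition regular_cond_distribution ::
    "'a measure \<Rightarrow> 'a measure \<Rightarrow> ('a \<Rightarrow> real) \<Rightarrow> ('a \<Rightarrow> real measure) \<Rightarrow> bool" where
  "regular_cond_distribution M F Y \<kappa> \<longleftrightarrow>
     \<kappa> \<in> F \<rightarrow>\<^sub>M prob_algebra borel \<and>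
     (\<forall>A\<in>sets borel. AE \<omega> in M.
        measure (\<kappa> \<omega>) A = real_cond_exp M F (indicat_real (Y -` A \<inter> space M)) \<omega>)"

definition continuity_modulus :: "('a \<Rightarrow> real measure) \<Rightarrow> real \<Rightarrow> 'a \<Rightarrow> real" where
  "continuity_modulus \<kappa> s \<omega> = (SUP t. measure (\<kappa> \<omega>) {t..t + s})"

text \<open>The supremum ranges over an uncountable set, so that measurability of the conditional
  continuity modulus is not automatic; it holds since \<open>t \<mapsto> \<mu> [t, t + s]\<close> is upper semicontinuous.\<close>

lemma bdd_above_prob_intervals:
  fixes \<mu> :: "real measure"
  assumes "prob_space \<mu>"
  shows "bdd_above (range (\<lambda>t. measure \<mu> {t..t + s}))"
  using prob_space.prob_le_1[OF assms] by (intro bdd_aboveI[of _ 1]) auto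

lemma le_SUP_prob_intervals_iff:
  fixes \<mu> :: "real measure"
  assumes \<mu>: "prob_space \<mu>" and sets: "sets \<mu> = sets borel" and s: "0 < s" and c: "0 < c"
  shows "c \<le> (SUP t. measure \<mu> {t..t + s}) \<longleftrightarrow>
    (\<forall>n::nat. \<exists>q::rat. c - 1 / (real n + 1)
       < measure \<mu> {real_of_rat q..real_of_rat q + s + 1 / (real n + 1)})"
    (is "?L \<longleftrightarrow> ?R")
proof
  interpret prob_space \<mu> by (rule \<mu>)
  have [measurable_cong, simp]: "sets \<mu> = sets borel" by (rule sets)
  {
    assume ?L
    show ?R
    proof
      fix n :: nat
      let ?e = "1 / (real n + 1)"
      have "c - ?e < (SUP t. measure \<mu> {t..t + s})"
        using \<open>?L\<close> by (smt (verit) divide_pos_pos of_nat_0_le_iff)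
      then obtain t where t: "c - ?e < measure \<mu> {t..t + s}"
        using less_cSUP_iff[OF _ bdd_above_prob_intervals[OF \<mu>]] by auto
      obtain q where q: "t - ?e < real_of_rat q" "real_of_rat q < t"
        using of_rat_dense[of "t - ?e" t] by auto
      have "measure \<mu> {t..t + s} \<le> measure \<mu> {real_of_rat q..real_of_rat q + s + ?e}"
        using q by (intro finite_measure_mono) auto
      with t show "\<exists>q. c - ?e < measure \<mu> {real_of_rat q..real_of_rat q + s + ?e}"
        by (intro exI[of _ q]) linarith
    qed
  }
  {
    assume ?R
    then obtain q where q: "\<And>n::nat. c - 1 / (real n + 1)
        < measure \<mu> {real_of_rat (q n)..real_of_rat (q n) + s + 1 / (real n + 1)}"
      by metis
    define x where "x n = real_of_rat (q n)" for n
    have x: "c - 1 / (real n + 1) < measure \<mu> {x n..x n + s + 1 / (real n + 1)}" for n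
      using q[of n] by (simp add: x_def)
    have lim0: "(\<lambda>n. 1 / (real n + 1)) \<longlonglongrightarrow> 0"
      using LIMSEQ_inverse_real_of_nat by (simp add: inverse_eq_divide add.commute)
    have "(\<lambda>n. measure \<mu> {-real n..real n}) \<longlonglongrightarrow> measure \<mu> (\<Union>n. {-real n..real n})"
      by (intro finite_Lim_measure_incseq) (auto simp: incseq_def)
    moreover have "(\<Union>n. {-real n..real n}) = space \<mu>"
    proof -
      have "\<exists>n. -real n \<le> y \<and> y \<le> real n" for y
        using real_arch_simple[of "\<bar>y\<bar>"] by (metis abs_le_iff minus_le_iff)
      then show ?thesis using sets_eq_imp_space_eq[OF sets] by auto
    qed
    ultimately have "(\<lambda>n. measure \<mu> {-real n..real n}) \<longlonglongrightarrow> 1"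
      by (simp add: prob_space)
    then have "eventually (\<lambda>n. 1 - c / 2 < measure \<mu> {-real n..real n}) sequentially"
      using c by (intro order_tendstoD(1)) auto
    then obtain B :: nat where B: "1 - c / 2 < measure \<mu> {-real B..real B}"
      by (auto simp: eventually_sequentially)
    have "eventually (\<lambda>n. 1 / (real n + 1) < c / 2) sequentially"
      using c by (intro order_tendstoD(2)[OF lim0]) auto
    then obtain n0 where n0: "\<And>n. n \<ge> n0 \<Longrightarrow> 1 / (real n + 1) < c / 2"
      by (auto simp: eventually_sequentially)
    have bnd: "x n \<in> {- real B - s - 1..real B}" if "n \<ge> n0" for n
    proof (rule ccontr)
      assume a: "x n \<notin> {- real B - s - 1..real B}"
      have "1 / (real n + 1) \<le> 1" by simp
      with a have "x n + s + 1 / (real n + 1) < - real B \<or> real B < x n"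
        unfolding atLeastAtMost_iff by linarith
      then have "{x n..x n + s + 1 / (real n + 1)} \<inter> {-real B..real B} = {}"
        by auto
      then have "measure \<mu> {x n..x n + s + 1 / (real n + 1)} + measure \<mu> {-real B..real B} \<le> 1"
        by (subst finite_measure_Union[symmetric]) auto
      with x[of n] n0[OF that] B show False by linarith
    qed
    have "compact {- real B - s - 1..real B}" by simp
    then obtain t r where r: "strict_mono r" "(\<lambda>n. x (r n + n0)) \<longlonglongrightarrow> t"
      using bnd seq_compactE[of "{- real B - s - 1..real B}" "\<lambda>n. x (n + n0)"]
      unfolding compact_eq_seq_compact_metric comp_def by (metis le_add2)
    define m where "m n = r n + n0" for n
    have "filterlim m sequentially sequentially"
      using filterlim_compose[OF filterlim_add_const_nat_at_top[of n0] filterlim_subseq[OF r(1)]]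
      by (simp add: m_def[abs_def])
    note lim1 = filterlim_compose[OF lim0 this]
    have lim2: "(\<lambda>n. x (m n)) \<longlonglongrightarrow> t" using r(2) by (simp add: m_def)
    have "c \<le> measure \<mu> {t - 1 / (real k + 1)..t + s + 1 / (real k + 1)}" for k :: nat
    proof (rule tendsto_le[of sequentially])
      let ?e = "1 / (real k + 1)"
      have "(\<lambda>n. c - 1 / (real (m n) + 1)) \<longlonglongrightarrow> c - 0"
        by (intro tendsto_diff tendsto_const lim1)
      then show "(\<lambda>n. c - 1 / (real (m n) + 1)) \<longlonglongrightarrow> c" by simp
      have "eventually (\<lambda>n. t - ?e < x (m n)) sequentially"
        by (intro order_tendstoD(1)[OF lim2]) auto
      moreover have "(\<lambda>n. x (m n) + 1 / (real (m n) + 1)) \<longlonglongrightarrow> t + 0"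
        by (intro tendsto_add lim1 lim2)
      then have "eventually (\<lambda>n. x (m n) + 1 / (real (m n) + 1) < t + ?e) sequentially"
        by (intro order_tendstoD(2)) auto
      ultimately show "eventually (\<lambda>n. c - 1 / (real (m n) + 1)
          \<le> measure \<mu> {t - ?e..t + s + ?e}) sequentially"
      proof eventually_elim
        case (elim n)
        then have "measure \<mu> {x (m n)..x (m n) + s + 1 / (real (m n) + 1)}
            \<le> measure \<mu> {t - ?e..t + s + ?e}"
          by (intro finite_measure_mono) auto
        with x[of "m n"] show ?case by linarith
      qed
    qed auto
    moreover have "(\<lambda>k. measure \<mu> {t - 1 / (real k + 1)..t + s + 1 / (real k + 1)})
        \<longlonglongrightarrow> measure \<mu> (\<Inter>k. {t - 1 / (real k + 1)..t + s + 1 / (real k + 1)})"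
    proof (intro finite_Lim_measure_decseq)
      have "1 / (real j + 1) \<le> 1 / (real i + 1)" if "i \<le> j" for i j
        using that by (simp add: frac_le)
      then show "decseq (\<lambda>k. {t - 1 / (real k + 1)..t + s + 1 / (real k + 1)})"
        unfolding decseq_def by (smt (verit) atLeastAtMost_iff subsetI)
    qed auto
    moreover have "(\<Inter>k. {t - 1 / (real k + 1)..t + s + 1 / (real k + 1)}) = {t..t + s}"
    proof (intro equalityI subsetI)
      fix y assume y: "y \<in> (\<Inter>k. {t - 1 / (real k + 1)..t + s + 1 / (real k + 1)})"
      have "(\<lambda>k. t - 1 / (real k + 1)) \<longlonglongrightarrow> t - 0" "(\<lambda>k. t + s + 1 / (real k + 1)) \<longlonglongrightarrow> t + s + 0"
        by (intro tendsto_intros lim0)+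
      then have "t - 0 \<le> y" "y \<le> t + s + 0"
        using y by (auto intro: LIMSEQ_le_const LIMSEQ_le_const2)
      then show "y \<in> {t..t + s}" by simp
    next
      fix y assume "y \<in> {t..t + s}"
      then show "y \<in> (\<Inter>k. {t - 1 / (real k + 1)..t + s + 1 / (real k + 1)})"
        by (auto intro: order_trans[of _ t] order_trans[of _ "t + s"])
    qed
    ultimately have "c \<le> measure \<mu> {t..t + s}"
      by (intro LIMSEQ_le_const) auto
    then show ?L
      by (rule order_trans) (intro cSUP_upper bdd_above_prob_intervals[OF \<mu>] UNIV_I)
  }
qed

lemma measurable_continuity_modulus:
  assumes \<kappa>: "\<kappa> \<in> F \<rightarrow>\<^sub>M prob_algebra borel" and s: "0 < s"
  shows "continuity_modulus \<kappa> s \<in> borel_measurable F"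
proof (subst borel_measurable_iff_ge, intro allI)
  fix c :: real
  have prob: "prob_space (\<kappa> \<omega>)" "sets (\<kappa> \<omega>) = sets borel" if "\<omega> \<in> space F" for \<omega>
    using measurable_space[OF \<kappa> that] by (auto simp: space_prob_algebra)
  note [measurable] = \<kappa>
  show "{\<omega> \<in> space F. c \<le> continuity_modulus \<kappa> s \<omega>} \<in> sets F"
  proof (cases "0 < c")
    case True
    have "{\<omega> \<in> space F. c \<le> continuity_modulus \<kappa> s \<omega>} =
      {\<omega> \<in> space F. \<forall>n::nat. \<exists>q::rat. c - 1 / (real n + 1)
       < measure (\<kappa> \<omega>) {real_of_rat q..real_of_rat q + s + 1 / (real n + 1)}}"
      using le_SUP_prob_intervals_iff[OF prob s True] by (auto simp: continuity_modulus_def)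
    also have "\<dots> \<in> sets F"
      by measurable
    finally show ?thesis .
  next
    case False
    have "c \<le> continuity_modulus \<kappa> s \<omega>" if "\<omega> \<in> space F" for \<omega>
    proof -
      have "measure (\<kappa> \<omega>) {0..0 + s} \<le> continuity_modulus \<kappa> s \<omega>"
        unfolding continuity_modulus_def
        by (intro cSUP_upper bdd_above_prob_intervals prob that UNIV_I)
      with False show ?thesis
        using measure_nonneg[of "\<kappa> \<omega>" "{0..0 + s}"] by linarith
    qed
    then have "{\<omega> \<in> space F. c \<le> continuity_modulus \<kappa> s \<omega>} = space F" by auto
    then show ?thesis by simp
  qed
qed

end

theory Submission
  imports Defs
begin

text \<open>
  The vector \<open>X\<close> is uniform on the box \<open>C = \<Prod> [a\<^sub>i, a\<^sub>i + \<ell>]\<close>, and the events of \<open>\<FF>\<^sub>\<eta>\<close> are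
  invariant under translation of \<open>X\<close> along the diagonal \<open>(1, \<dots>, 1)\<close>. Hence, given the fluctuations,
  the sample mean is uniform on an interval whose length \<open>L\<close> is that of the section of \<open>C\<close> by the
  diagonal line through \<open>X\<close>, and \<open>L \<nu>\<^sub>N(s) \<le> s\<close>. So \<open>\<nu>\<^sub>N(s) \<ge> s / \<delta>\<close> forces \<open>L \<le> \<delta>\<close>; as \<open>L\<close> is at
  least \<open>min\<^sub>i (X\<^sub>i - a\<^sub>i)\<close>, some \<open>X\<^sub>i\<close> then lies in \<open>[a\<^sub>i, a\<^sub>i + \<delta>]\<close>, and a union bound concludes.
  Instead of a disintegration of the law of \<open>X\<close>, only the inequality
  \<open>\<integral>\<^sub>A L 1{\<xi>\<^sub>N \<in> [p, q]} \<le> (q - p) P(A)\<close> for \<open>A \<in> \<FF>\<^sub>\<eta>\<close> is needed.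
\<close>

section \<open>Products of uniform distributions\<close>

text \<open>The divisors must be nonzero because \<open>inverse\<close> on \<open>ennreal\<close>
  fails to be multiplicative on the pair \<open>0\<close>, \<open>top\<close>.\<close>

lemma prod_divide_ennreal:
  fixes f g :: "'i \<Rightarrow> ennreal"
  assumes "\<And>i. i \<in> I \<Longrightarrow> g i \<noteq> 0"
  shows "(\<Prod>i\<in>I. f i / g i) = (\<Prod>i\<in>I. f i) / (\<Prod>i\<in>I. g i)"
  using assms
proof (induction I rule: infinite_finite_induct)
  case (insert i I)
  then have "g i \<noteq> 0" "(\<Prod>i\<in>I. g i) \<noteq> 0" by auto
  then have "inverse (g i * (\<Prod>i\<in>I. g i)) = inverse (g i) * inverse (\<Prod>i\<in>I. g i)"
    by (intro ennreal_inverse_mult') (auto simp: zero_less_iff_neq_zero)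
  with insert show ?case
    by (simp add: divide_ennreal_def mult_ac)
qed (auto simp: divide_ennreal_def)

text \<open>Both measures agree on boxes, since the normalised mass of a box factors over the
  coordinates. This is what makes independent uniform variables jointly uniform on a box.\<close>

lemma (in product_sigma_finite) PiM_uniform_measure:
  assumes I: "finite I" and A: "\<And>i. i \<in> I \<Longrightarrow> A i \<in> sets (M i)"
    and pos: "\<And>i. i \<in> I \<Longrightarrow> emeasure (M i) (A i) \<noteq> 0"
    and fin: "\<And>i. i \<in> I \<Longrightarrow> emeasure (M i) (A i) \<noteq> \<infinity>"
  shows "PiM I (\<lambda>i. uniform_measure (M i) (A i)) = uniform_measure (PiM I M) (PiE I A)"
proof -
  \<comment> \<open>\<open>A\<close> is unrestricted outside \<open>I\<close>, whereas
    \<open>product_sigma_finite\<close> asks for sigma-finiteness at every index; \<open>U\<close>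
    therefore falls back on \<open>M i\<close> there.\<close>
  define U where "U i = (if i \<in> I then uniform_measure (M i) (A i) else M i)" for i
  have "sigma_finite_measure (U i)" for i
    unfolding U_def using sigma_finite_measures[of i] prob_space_uniform_measure[OF pos fin, of i]
    by (auto intro: prob_space_imp_sigma_finite)
  then interpret U: product_sigma_finite U
    by (simp add: product_sigma_finite_def)
  have sets_U: "sets (PiM I U) = sets (PiM I M)"
    by (intro sets_PiM_cong) (auto simp: U_def)
  have A_sets: "PiE I A \<in> sets (PiM I M)"
    using A I by (intro sets_PiM_I_finite) auto
  have "uniform_measure (PiM I M) (PiE I A) = PiM I U"
  proof (intro U.PiM_eqI I)
    show "sets (uniform_measure (PiM I M) (PiE I A)) = sets (PiM I U)"
      by (simp add: sets_U)
    fix B assume "\<And>i. i \<in> I \<Longrightarrow> B i \<in> sets (U i)"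
    then have B: "B i \<in> sets (M i)" if "i \<in> I" for i
      using that by (auto simp: U_def)
    have "emeasure (uniform_measure (PiM I M) (PiE I A)) (PiE I B)
        = emeasure (PiM I M) (PiE I (\<lambda>i. A i \<inter> B i)) / emeasure (PiM I M) (PiE I A)"
      using A_sets B I by (simp add: PiE_Int sets_PiM_I_finite)
    also have "\<dots> = (\<Prod>i\<in>I. emeasure (M i) (A i \<inter> B i)) / (\<Prod>i\<in>I. emeasure (M i) (A i))"
      using A B I by (simp add: emeasure_PiM)
    also have "\<dots> = (\<Prod>i\<in>I. emeasure (M i) (A i \<inter> B i) / emeasure (M i) (A i))"
      using pos by (intro prod_divide_ennreal[symmetric])
    also have "\<dots> = (\<Prod>i\<in>I. emeasure (U i) (B i))"
      using A B by (intro prod.cong) (auto simp: U_def)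
    finally show "emeasure (uniform_measure (PiM I M) (PiE I A)) (PiE I B)
        = (\<Prod>i\<in>I. emeasure (U i) (B i))" .
  qed
  also have "PiM I U = PiM I (\<lambda>i. uniform_measure (M i) (A i))"
    by (intro PiM_cong) (auto simp: U_def)
  finally show ?thesis ..
qed

section \<open>Translation along the diagonal\<close>

text \<open>Restricting to \<open>I\<close> keeps the result in the space of \<open>PiM I\<close>;
  the price is that translation by \<open>0\<close> is the identity only on extensional
  functions.\<close>

definition diag_translate :: "'i set \<Rightarrow> real \<Rightarrow> ('i \<Rightarrow> real) \<Rightarrow> 'i \<Rightarrow> real" where
  "diag_translate I u x = (\<lambda>i\<in>I. x i + u)"

lemma measurable_diag_translate [measurable (raw)]:
  assumes "f \<in> borel_measurable M" "g \<in> M \<rightarrow>\<^sub>M PiM I (\<lambda>_. borel)"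
  shows "(\<lambda>w. diag_translate I (f w) (g w)) \<in> M \<rightarrow>\<^sub>M PiM I (\<lambda>_. borel)"
  unfolding diag_translate_def
proof (rule measurable_restrict)
  fix i assume "i \<in> I"
  from measurable_compose[OF assms(2) measurable_component_singleton[OF this]] assms(1)
  show "(\<lambda>w. g w i + f w) \<in> borel_measurable M" by simp
qed

lemma diag_translate_translate:
  "diag_translate I u (diag_translate I v x) = diag_translate I (u + v) x"
  by (auto simp: diag_translate_def fun_eq_iff)

lemma diag_translate_0: "x \<in> extensional I \<Longrightarrow> diag_translate I 0 x = x"
  by (auto simp: diag_translate_def fun_eq_iff extensional_def)

lemma sets_PiM_lborel [measurable_cong]:
  "sets (PiM I (\<lambda>_. lborel)) = sets (PiM I (\<lambda>_. borel))"
  by (intro sets_PiM_cong) auto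

lemma nn_integral_lborel_translate:
  fixes c :: real
  assumes "f \<in> borel_measurable borel"
  shows "(\<integral>\<^sup>+u. f (u + c) \<partial>lborel) = (\<integral>\<^sup>+u. f u \<partial>lborel)"
  using nn_integral_real_affine[OF assms, of 1 c] by (simp add: add.commute)

text \<open>It suffices to compare boxes: the preimage of a box is a box with shifted sides, and
  each side keeps its one-dimensional Lebesgue measure.\<close>

lemma distr_PiM_lborel_diag_translate:
  assumes I: "finite I"
  shows "distr (PiM I (\<lambda>_. lborel)) (PiM I (\<lambda>_. borel)) (diag_translate I u) = PiM I (\<lambda>_. lborel)"
proof -
  interpret product_sigma_finite "\<lambda>_. lborel :: real measure" ..
  show ?thesis
  proof (intro PiM_eqI I)
    show "sets (distr (PiM I (\<lambda>_. lborel)) (PiM I (\<lambda>_. borel)) (diag_translate I u))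
        = sets (PiM I (\<lambda>_. lborel))"
      by (simp add: sets_PiM_lborel)
    fix A :: "'a \<Rightarrow> real set" assume "\<And>i. i \<in> I \<Longrightarrow> A i \<in> sets lborel"
    then have A: "A i \<in> sets borel" if "i \<in> I" for i using that by auto
    have vim: "(\<lambda>x. x + u) -` A i \<in> sets borel" if "i \<in> I" for i
    proof -
      have "(\<lambda>x. x + u) \<in> borel_measurable (borel :: real measure)" by measurable
      from measurable_sets[OF this A[OF that]] show ?thesis by simp
    qed
    have "diag_translate I u -` PiE I A \<inter> space (PiM I (\<lambda>_. lborel))
        = PiE I (\<lambda>i. (\<lambda>x. x + u) -` A i)"
      by (auto simp: diag_translate_def space_PiM PiE_iff)
    then have "emeasure (distr (PiM I (\<lambda>_. lborel)) (PiM I (\<lambda>_. borel)) (diag_translate I u)) (PiE I A)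
        = emeasure (PiM I (\<lambda>_. lborel)) (PiE I (\<lambda>i. (\<lambda>x. x + u) -` A i))"
      using A I by (subst emeasure_distr) (auto intro!: sets_PiM_I_finite)
    also have "\<dots> = (\<Prod>i\<in>I. emeasure lborel ((\<lambda>x. x + u) -` A i))"
      using vim I by (intro emeasure_PiM) auto
    also have "\<dots> = (\<Prod>i\<in>I. emeasure lborel (A i))"
    proof (intro prod.cong refl)
      fix i assume i: "i \<in> I"
      have "emeasure lborel (A i) = emeasure (distr lborel borel ((+) u)) (A i)"
        by (simp add: lborel_distr_plus)
      also have "\<dots> = emeasure lborel ((\<lambda>x. x + u) -` A i)"
        using A[OF i] by (subst emeasure_distr) (auto simp: vimage_def add.commute)
      finally show "emeasure lborel ((\<lambda>x. x + u) -` A i) = emeasure lborel (A i)" ..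
    qed
    finally show "emeasure (distr (PiM I (\<lambda>_. lborel)) (PiM I (\<lambda>_. borel)) (diag_translate I u)) (PiE I A)
        = (\<Prod>i\<in>I. emeasure lborel (A i))" .
  qed
qed

section \<open>Lengths of diagonal sections\<close>

text \<open>Length is measured in the translation parameter, that is, Euclidean length divided by
  the square root of \<open>card I\<close>, so that the sample mean moves at unit speed along the
  line. Values are in \<open>ennreal\<close> because the section of a general \<open>C\<close> may
  be infinitely long.\<close>

definition diag_length :: "'i set \<Rightarrow> ('i \<Rightarrow> real) set \<Rightarrow> ('i \<Rightarrow> real) \<Rightarrow> ennreal" where
  "diag_length I C x = (\<integral>\<^sup>+u. indicator C (diag_translate I u x) \<partial>lborel)"

lemma measurable_diag_length [measurable]:
  assumes [measurable]: "C \<in> sets (PiM I (\<lambda>_. borel))"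
  shows "diag_length I C \<in> borel_measurable (PiM I (\<lambda>_. borel))"
  unfolding diag_length_def[abs_def] by measurable

text \<open>Moving the base point only shifts the parameter on the same line. Thus the length
  depends on the fluctuations alone.\<close>

lemma diag_length_translate:
  assumes [measurable]: "C \<in> sets (PiM I (\<lambda>_. borel))" and x: "x \<in> space (PiM I (\<lambda>_. borel))"
  shows "diag_length I C (diag_translate I c x) = diag_length I C x"
proof -
  have [measurable]: "(\<lambda>u. diag_translate I u x) \<in> borel \<rightarrow>\<^sub>M PiM I (\<lambda>_. borel)"
    using x by measurable
  have "(\<lambda>u. indicator C (diag_translate I u x) :: ennreal) \<in> borel_measurable borel"
    by measurable
  from nn_integral_lborel_translate[OF this, of c] show ?thesis
    by (simp add: diag_length_def diag_translate_translate)
qed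

text \<open>By Fubini and translation invariance, the mass at a point of \<open>C\<close> may be averaged along the
  diagonal line through it; \<open>h\<close> is a coordinate on that line, so the weight it then receives
  is at most the length of \<open>[p, q]\<close>.\<close>

lemma nn_integral_diag_length_le:
  fixes h :: "('i \<Rightarrow> real) \<Rightarrow> real" and f :: "('i \<Rightarrow> real) \<Rightarrow> ennreal"
  assumes I: "finite I" and pq: "p \<le> q"
    and C [measurable]: "C \<in> sets (PiM I (\<lambda>_. borel))"
    and f [measurable]: "f \<in> borel_measurable (PiM I (\<lambda>_. borel))"
    and h [measurable]: "h \<in> borel_measurable (PiM I (\<lambda>_. borel))"
    and f_inv: "\<And>x u. f (diag_translate I u x) = f x"
    and h_equiv: "\<And>x u. h (diag_translate I u x) = h x + u"
  shows "(\<integral>\<^sup>+x. f x * indicator {p..q} (h x) * diag_length I C x * indicator C x \<partial>PiM I (\<lambda>_. lborel))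
    \<le> ennreal (q - p) * (\<integral>\<^sup>+x. f x * indicator C x \<partial>PiM I (\<lambda>_. lborel))"
proof -
  let ?P = "PiM I (\<lambda>_. lborel :: real measure)"
  interpret product_sigma_finite "\<lambda>_. lborel :: real measure" ..
  interpret P: sigma_finite_measure ?P by (rule sigma_finite[OF I])
  interpret pair_sigma_finite ?P lborel ..
  let ?t = "diag_translate I"
  let ?g = "\<lambda>x u. f x * indicator {p..q} (h x) * indicator C x * indicator C (?t u x) :: ennreal"
  \<comment> \<open>This is \<open>?g\<close> at \<open>?t (-u) x\<close> instead of
    \<open>x\<close>: the factor \<open>f\<close> stays, \<open>h\<close> drops by \<open>u\<close>,
    and the two indicators of \<open>C\<close> exchange roles.\<close>
  let ?g' = "\<lambda>x u. f x * indicator C x * (indicator {p..q} (h x - u) * indicator C (?t (-u) x)) :: ennreal"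
  have shift: "(\<integral>\<^sup>+x. k (?t u x) \<partial>?P) = (\<integral>\<^sup>+x. k x \<partial>?P)"
    if [measurable]: "k \<in> borel_measurable (PiM I (\<lambda>_. borel))" for k and u
    by (subst (2) distr_PiM_lborel_diag_translate[OF I, of u, symmetric])
      (simp add: nn_integral_distr)
  have "(\<integral>\<^sup>+x. f x * indicator {p..q} (h x) * diag_length I C x * indicator C x \<partial>?P)
      = (\<integral>\<^sup>+x. (\<integral>\<^sup>+u. ?g x u \<partial>lborel) \<partial>?P)"
  proof (intro nn_integral_cong)
    fix x assume "x \<in> space ?P"
    then have [measurable]: "(\<lambda>u. diag_translate I u x) \<in> borel \<rightarrow>\<^sub>M PiM I (\<lambda>_. borel)"
      by (intro measurable_diag_translate) (auto simp: space_PiM)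
    show "f x * indicator {p..q} (h x) * diag_length I C x * indicator C x = (\<integral>\<^sup>+u. ?g x u \<partial>lborel)"
      unfolding diag_length_def by (subst nn_integral_cmult) (auto simp: mult_ac)
  qed
  also have "\<dots> = (\<integral>\<^sup>+u. (\<integral>\<^sup>+x. ?g x u \<partial>?P) \<partial>lborel)"
    by (intro Fubini'[symmetric]) measurable
  also have "\<dots> = (\<integral>\<^sup>+u. (\<integral>\<^sup>+x. ?g' x u \<partial>?P) \<partial>lborel)"
  proof (rule nn_integral_cong)
    fix u :: real
    have "(\<integral>\<^sup>+x. ?g x u \<partial>?P) = (\<integral>\<^sup>+x. ?g (?t (-u) x) u \<partial>?P)"
      by (rule shift[symmetric]) measurable
    also have "\<dots> = (\<integral>\<^sup>+x. ?g' x u \<partial>?P)"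
      by (intro nn_integral_cong)
        (auto simp: f_inv h_equiv diag_translate_translate space_PiM PiE_def diag_translate_0 mult_ac)
    finally show "(\<integral>\<^sup>+x. ?g x u \<partial>?P) = (\<integral>\<^sup>+x. ?g' x u \<partial>?P)" .
  qed
  also have "\<dots> = (\<integral>\<^sup>+x. (\<integral>\<^sup>+u. ?g' x u \<partial>lborel) \<partial>?P)"
    by (intro Fubini') measurable
  also have "\<dots> \<le> (\<integral>\<^sup>+x. ennreal (q - p) * (f x * indicator C x) \<partial>?P)"
  proof (intro nn_integral_mono)
    fix x
    \<comment> \<open>Discarding the condition that \<open>?t (-u) x\<close> lies in
      \<open>C\<close> costs the equality; what remains restricts \<open>u\<close> to an interval of
      length \<open>q - p\<close>.\<close>
    have "(\<integral>\<^sup>+u. ?g' x u \<partial>lborel) \<le> (\<integral>\<^sup>+u. f x * indicator C x * indicator {h x - q..h x - p} u \<partial>lborel)"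
      by (intro nn_integral_mono) (auto simp: indicator_def)
    also have "\<dots> = ennreal (q - p) * (f x * indicator C x)"
      using pq by (subst nn_integral_cmult_indicator) (auto simp: mult_ac)
    finally show "(\<integral>\<^sup>+u. ?g' x u \<partial>lborel) \<le> ennreal (q - p) * (f x * indicator C x)" .
  qed
  also have "\<dots> = ennreal (q - p) * (\<integral>\<^sup>+x. f x * indicator C x \<partial>?P)"
    by (intro nn_integral_cmult) measurable
  finally show ?thesis .
qed

section \<open>From averaged bounds to the conditional distribution\<close>

text \<open>The hypothesis is tested on the event where the conditional expectation exceeds
  \<open>c\<close>, which lies in \<open>F\<close>. There the excess is positive with integral at
  most zero, so the event is null.\<close>

lemma (in finite_measure_subalgebra) real_cond_exp_le_const:
  assumes f: "integrable M f"
    and le: "\<And>A. A \<in> sets F \<Longrightarrow> (\<integral>x\<in>A. f x \<partial>M) \<le> c * measure M A"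
  shows "AE x in M. real_cond_exp M F f x \<le> c"
proof -
  let ?h = "real_cond_exp M F f"
  define A where "A = {x \<in> space F. c < ?h x}"
  have A_F: "A \<in> sets F"
    unfolding A_def by measurable
  have A [measurable]: "A \<in> sets M"
    using A_F subalg by (auto simp: subalgebra_def)
  have h: "integrable M ?h"
    by (rule real_cond_exp_int(1)[OF f])
  have int_h: "integrable M (\<lambda>x. indicator A x * ?h x)"
    using integrable_mult_indicator[OF A h] by simp
  have int_c: "integrable M (\<lambda>x. indicator A x * c)"
    using integrable_mult_indicator[OF A, of "\<lambda>_. c"] by simp
  have int: "integrable M (\<lambda>x. indicator A x * (?h x - c))"
    using Bochner_Integration.integrable_diff[OF int_h int_c] by (simp add: algebra_simps)
  have nonneg: "0 \<le> indicator A x * (?h x - c)" for x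
    by (auto simp: A_def indicator_def)
  have "(\<integral>x. indicator A x * (?h x - c) \<partial>M) = (\<integral>x. indicator A x * ?h x - indicator A x * c \<partial>M)"
    by (simp add: algebra_simps)
  also have "\<dots> = (\<integral>x\<in>A. ?h x \<partial>M) - (\<integral>x. indicator A x * c \<partial>M)"
    using int_h int_c by (subst Bochner_Integration.integral_diff) (auto simp: set_lebesgue_integral_def)
  also have "\<dots> = (\<integral>x\<in>A. f x \<partial>M) - c * measure M A"
    using real_cond_exp_intA[OF f A_F] sets.sets_into_space[OF A] by (simp add: Int_absorb1 Int_absorb2)
  also have "\<dots> \<le> 0"
    using le[OF A_F] by simp
  finally have "(\<integral>x. indicator A x * (?h x - c) \<partial>M) = 0"
    using nonneg by (intro antisym integral_nonneg_AE) auto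
  then have "AE x in M. indicator A x * (?h x - c) = 0"
    using integral_nonneg_eq_0_iff_AE[OF int] nonneg by auto
  then show ?thesis
    using AE_space
    by eventually_elim (use subalg in \<open>auto simp: A_def indicator_def subalgebra_def split: if_splits\<close>)
qed

text \<open>Being \<open>F\<close>-measurable, \<open>L\<close> can be pulled out of the conditional
  expectation, which turns the averaged bound into an almost sure bound on \<open>L\<close> times
  the conditional probability of each fixed interval. The constant \<open>K\<close> serves for
  integrability.\<close>

lemma AE_mult_continuity_modulus_le:
  assumes M: "prob_space M" and sub: "subalgebra M F"
    and \<kappa>: "regular_cond_distribution M F Y \<kappa>"
    and Y [measurable]: "Y \<in> borel_measurable M"
    and L: "L \<in> borel_measurable F" "\<And>\<omega>. 0 \<le> L \<omega>" "\<And>\<omega>. \<omega> \<in> space M \<Longrightarrow> L \<omega> \<le> K"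
    and le: "\<And>p q A. p \<le> q \<Longrightarrow> A \<in> sets F \<Longrightarrow>
      (\<integral>\<omega>\<in>A. L \<omega> * indicator {p..q} (Y \<omega>) \<partial>M) \<le> (q - p) * measure M A"
  shows "AE \<omega> in M. \<forall>s>0. L \<omega> * continuity_modulus \<kappa> s \<omega> \<le> s"
proof -
  interpret prob_space M by (rule M)
  interpret finite_measure_subalgebra M F by unfold_locales (rule sub)
  have [measurable]: "L \<in> borel_measurable M"
    by (rule measurable_from_subalg[OF sub L(1)])
  have "AE \<omega> in M. p \<le> q \<longrightarrow> L \<omega> * measure (\<kappa> \<omega>) {p..q} \<le> q - p" for p q
  proof (cases "p \<le> q")
    case True
    let ?Z = "indicat_real (Y -` {p..q} \<inter> space M)"
    have Z: "?Z \<in> borel_measurable M" by measurable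
    have int: "integrable M (\<lambda>\<omega>. L \<omega> * ?Z \<omega>)"
    proof (rule integrable_const_bound[where B = K])
      show "AE \<omega> in M. norm (L \<omega> * ?Z \<omega>) \<le> K"
        by (intro AE_I2) (use L in \<open>auto simp: indicator_def intro: order_trans\<close>)
    qed measurable
    have "AE \<omega> in M. real_cond_exp M F (\<lambda>\<omega>. L \<omega> * ?Z \<omega>) \<omega> \<le> q - p"
    proof (rule real_cond_exp_le_const[OF int])
      fix A assume A: "A \<in> sets F"
      have "(\<integral>\<omega>\<in>A. L \<omega> * ?Z \<omega> \<partial>M) = (\<integral>\<omega>\<in>A. L \<omega> * indicator {p..q} (Y \<omega>) \<partial>M)"
        unfolding set_lebesgue_integral_def
        by (intro Bochner_Integration.integral_cong) (auto simp: indicator_def)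
      also note le[OF True A]
      finally show "(\<integral>\<omega>\<in>A. L \<omega> * ?Z \<omega> \<partial>M) \<le> (q - p) * measure M A" .
    qed
    moreover have "AE \<omega> in M. real_cond_exp M F (\<lambda>\<omega>. L \<omega> * ?Z \<omega>) \<omega> = L \<omega> * real_cond_exp M F ?Z \<omega>"
      by (rule real_cond_exp_mult[OF L(1) Z int])
    moreover have "AE \<omega> in M. measure (\<kappa> \<omega>) {p..q} = real_cond_exp M F ?Z \<omega>"
      using \<kappa> by (auto simp: regular_cond_distribution_def)
    ultimately show ?thesis
      by eventually_elim simp
  qed simp
  \<comment> \<open>Only countably many null sets may be combined, hence the rational endpoints; the
    modulus is a supremum over uncountably many intervals.\<close>
  then have "AE \<omega> in M. \<forall>p q :: rat. real_of_rat p \<le> real_of_rat q \<longrightarrow>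
      L \<omega> * measure (\<kappa> \<omega>) {real_of_rat p..real_of_rat q} \<le> real_of_rat q - real_of_rat p"
    by (simp add: AE_all_countable)
  then show ?thesis
    using AE_space
  proof eventually_elim
    case (elim \<omega>)
    have "\<omega> \<in> space F" using elim(2) sub by (simp add: subalgebra_def)
    then have "\<kappa> \<omega> \<in> space (prob_algebra borel)"
      using \<kappa> by (auto simp: regular_cond_distribution_def dest: measurable_space)
    then interpret \<kappa>: prob_space "\<kappa> \<omega>" by (simp add: space_prob_algebra)
    have sets_\<kappa>: "sets (\<kappa> \<omega>) = sets borel"
      using \<open>\<kappa> \<omega> \<in> space (prob_algebra borel)\<close> by (simp add: space_prob_algebra)
    \<comment> \<open>An arbitrary interval is enclosed in a rational one that is longer by at most
      \<open>e\<close>.\<close>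
    have *: "L \<omega> * measure (\<kappa> \<omega>) {t..t + s} \<le> s" if s: "0 < s" for s t
    proof (rule field_le_epsilon)
      fix e :: real assume e: "0 < e"
      obtain p where p: "t - e / 2 < real_of_rat p" "real_of_rat p < t"
        using of_rat_dense[of "t - e / 2" t] e by auto
      obtain q where q: "t + s < real_of_rat q" "real_of_rat q < t + s + e / 2"
        using of_rat_dense[of "t + s" "t + s + e / 2"] e by auto
      have "L \<omega> * measure (\<kappa> \<omega>) {t..t + s} \<le> L \<omega> * measure (\<kappa> \<omega>) {real_of_rat p..real_of_rat q}"
        using p q L(2) by (intro mult_left_mono \<kappa>.finite_measure_mono) (auto simp: sets_\<kappa>)
      also have "\<dots> \<le> real_of_rat q - real_of_rat p"
      proof -
        have "real_of_rat p \<le> real_of_rat q" using p q s by linarith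
        with elim(1) show ?thesis by blast
      qed
      also have "\<dots> \<le> s + e"
        using p q by linarith
      finally show "L \<omega> * measure (\<kappa> \<omega>) {t..t + s} \<le> s + e" .
    qed
    show "\<forall>s>0. L \<omega> * continuity_modulus \<kappa> s \<omega> \<le> s"
    proof (intro allI impI)
      fix s :: real assume s: "0 < s"
      show "L \<omega> * continuity_modulus \<kappa> s \<omega> \<le> s"
      proof (cases "L \<omega> = 0")
        case False
        with L(2)[of \<omega>] have pos: "0 < L \<omega>" by simp
        have "continuity_modulus \<kappa> s \<omega> \<le> s / L \<omega>"
          unfolding continuity_modulus_def
          using *[OF s] pos by (intro cSUP_least) (auto simp: field_simps)
        with pos show ?thesis by (simp add: field_simps)
      qed (use s in simp)
    qed
  qed
qed

section \<open>Sections of a box\<close>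

lemma sample_mean_diag_translate:
  assumes "N \<ge> 1"
  shows "sample_mean N (\<lambda>i x. x i) (diag_translate {1..N} u x) = sample_mean N (\<lambda>i x. x i) x + u"
  using assms by (simp add: sample_mean_def diag_translate_def sum.distrib field_simps)

text \<open>One coordinate suffices: keeping coordinate \<open>i\<close> within its side confines
  the parameter to \<open>{a i - x i..a i + l - x i}\<close>.\<close>

lemma diag_length_box_le:
  assumes i: "i \<in> I"
  shows "diag_length I (\<Pi>\<^sub>E i\<in>I. {a i..a i + l}) x \<le> ennreal l"
proof -
  have "diag_length I (\<Pi>\<^sub>E i\<in>I. {a i..a i + l}) x
      \<le> (\<integral>\<^sup>+u. indicator {a i - x i..a i + l - x i} u \<partial>lborel)"
    unfolding diag_length_def
    by (intro nn_integral_mono) (use i in \<open>auto simp: indicator_def diag_translate_def PiE_iff split: if_splits\<close>)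
  also have "\<dots> \<le> ennreal l"
    by (cases "0 \<le> l") (auto simp: ennreal_neg)
  finally show ?thesis .
qed

text \<open>A point of the box can slide down the diagonal by the smallest of the gaps
  \<open>x i - a i\<close> before it leaves through a lower face. As \<open>I\<close> is finite,
  this minimum is still strictly larger than \<open>\<delta>\<close>.\<close>

lemma diag_length_box_gt:
  assumes I: "finite I" "I \<noteq> {}" and \<delta>: "0 < \<delta>"
    and x: "x \<in> (\<Pi>\<^sub>E i\<in>I. {a i..a i + l})" and gt: "\<And>i. i \<in> I \<Longrightarrow> a i + \<delta> < x i"
  shows "ennreal \<delta> < diag_length I (\<Pi>\<^sub>E i\<in>I. {a i..a i + l}) x"
proof -
  define m where "m = Min ((\<lambda>i. x i - a i) ` I)"
  have m: "m \<le> x i - a i" if "i \<in> I" for i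
    unfolding m_def using I that by (intro Min_le) auto
  have \<delta>m: "\<delta> < m"
    unfolding m_def using I gt by (subst Min_gr_iff) (auto simp: algebra_simps)
  \<comment> \<open>Sliding down preserves the upper bounds, which hold at \<open>x\<close>
    already.\<close>
  have box: "diag_translate I u x \<in> (\<Pi>\<^sub>E i\<in>I. {a i..a i + l})" if u: "-m \<le> u" "u \<le> 0" for u
  proof (rule PiE_I)
    fix i assume i: "i \<in> I"
    have "x i \<in> {a i..a i + l}" using x i by auto
    then show "diag_translate I u x i \<in> {a i..a i + l}"
      using m[OF i] u i by (auto simp: diag_translate_def)
  qed (simp add: diag_translate_def)
  have "ennreal \<delta> < ennreal m"
    using \<delta> \<delta>m by (simp add: ennreal_less_iff)
  also have "\<dots> = (\<integral>\<^sup>+u. indicator {-m..0} u \<partial>lborel)"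
    using \<delta> \<delta>m by simp
  also have "\<dots> \<le> diag_length I (\<Pi>\<^sub>E i\<in>I. {a i..a i + l}) x"
    unfolding diag_length_def
    by (intro nn_integral_mono) (use box in \<open>auto simp: indicator_def\<close>)
  finally show ?thesis .
qed

section \<open>The sigma-algebra of the fluctuations\<close>

lemma measurable_fluctuation:
  assumes "i \<in> {1..N}"
  shows "fluctuation N X i \<in> borel_measurable (fluctuation_algebra M N X)"
proof (rule measurableI)
  fix A :: "real set" assume "A \<in> sets borel"
  then show "fluctuation N X i -` A \<inter> space (fluctuation_algebra M N X) \<in> sets (fluctuation_algebra M N X)"
    using assms unfolding fluctuation_algebra_def
    by (subst space_measure_of) (auto intro!: in_measure_of)
qed simp

text \<open>The coordinates and the whole vector generate the same events, so each event becomes the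
  preimage of a single measurable set under the vector of fluctuations.\<close>

lemma fluctuation_algebra_eq_vimage_algebra:
  "sets (fluctuation_algebra M N X) = sets (vimage_algebra (space M)
     (\<lambda>\<omega>. \<lambda>i\<in>{1..N}. fluctuation N X i \<omega>) (PiM {1..N} (\<lambda>_. borel)))"
  (is "_ = sets (vimage_algebra _ ?\<phi> ?P)")
proof (rule antisym)
  have space: "space (fluctuation_algebra M N X) = space M"
    unfolding fluctuation_algebra_def by (intro space_measure_of) auto
  have \<phi>: "?\<phi> \<in> vimage_algebra (space M) ?\<phi> ?P \<rightarrow>\<^sub>M ?P"
    by (rule measurable_vimage_algebra1) (auto simp: space_PiM)
  have "fluctuation N X i -` A \<inter> space M \<in> sets (vimage_algebra (space M) ?\<phi> ?P)"
    if i: "i \<in> {1..N}" and A: "A \<in> sets borel" for i A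
  proof -
    have "(\<lambda>\<omega>. ?\<phi> \<omega> i) \<in> borel_measurable (vimage_algebra (space M) ?\<phi> ?P)"
      by (rule measurable_compose[OF \<phi> measurable_component_singleton[OF i]])
    from measurable_sets[OF this A] i show ?thesis by (simp add: vimage_def)
  qed
  then have "sigma_sets (space (vimage_algebra (space M) ?\<phi> ?P))
      {fluctuation N X i -` A \<inter> space M |i A. i \<in> {1..N} \<and> A \<in> sets borel}
      \<subseteq> sets (vimage_algebra (space M) ?\<phi> ?P)"
    by (intro sets.sigma_sets_subset) blast
  then show "sets (fluctuation_algebra M N X) \<subseteq> sets (vimage_algebra (space M) ?\<phi> ?P)"
    unfolding fluctuation_algebra_def space_vimage_algebra by (subst sets_measure_of) auto
  have "?\<phi> \<in> fluctuation_algebra M N X \<rightarrow>\<^sub>M ?P"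
    by (intro measurable_restrict measurable_fluctuation)
  from measurable_sets[OF this]
  show "sets (vimage_algebra (space M) ?\<phi> ?P) \<subseteq> sets (fluctuation_algebra M N X)"
    by (subst sets_vimage_algebra2) (auto simp: space_PiM space)
qed

section \<open>The modulus for a uniform law on a general set\<close>

text \<open>Section length and the events of the fluctuation algebra are pulled back from functions
  and sets on the coordinate space that are invariant under diagonal translation. The integral bound
  for sections then supplies the hypothesis of \<open>AE_mult_continuity_modulus_le\<close>.\<close>

lemma AE_uniform_continuity_modulus_le:
  fixes M :: "'a measure" and N :: nat and X :: "nat \<Rightarrow> 'a \<Rightarrow> real"
  defines "V \<equiv> \<lambda>\<omega>. \<lambda>i\<in>{1..N}. X i \<omega>"
  assumes M: "prob_space M" and N: "N \<ge> 1"
    and C [measurable]: "C \<in> sets (PiM {1..N} (\<lambda>_. borel))"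
    and K: "0 \<le> K" and bound: "\<And>x. diag_length {1..N} C x \<le> ennreal K"
    and X: "\<And>i. i \<in> {1..N} \<Longrightarrow> X i \<in> borel_measurable M"
    and D: "distr M (PiM {1..N} (\<lambda>_. borel)) V = uniform_measure (PiM {1..N} (\<lambda>_. lborel)) C"
    and \<kappa>: "regular_cond_distribution M (fluctuation_algebra M N X) (sample_mean N X) \<kappa>"
  shows "AE \<omega> in M. \<forall>s>0. enn2real (diag_length {1..N} C (V \<omega>)) * continuity_modulus \<kappa> s \<omega> \<le> s"
proof -
  let ?I = "{1..N}" and ?F = "fluctuation_algebra M N X"
  let ?P = "PiM ?I (\<lambda>_. borel :: real measure)"
  interpret prob_space M by (rule M)
  define h where "h = sample_mean N (\<lambda>i x. x i :: real)"
  \<comment> \<open>\<open>\<phi>\<close> picks the point of mean zero on each diagonal line;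
    composed with \<open>V\<close> it is the vector of fluctuations.\<close>
  define \<phi> where "\<phi> x = diag_translate ?I (- h x) x" for x
  have V [measurable]: "V \<in> M \<rightarrow>\<^sub>M ?P"
    unfolding V_def using X by (intro measurable_restrict) auto
  have h [measurable]: "h \<in> borel_measurable ?P"
    unfolding h_def sample_mean_def[abs_def]
    by (intro borel_measurable_divide borel_measurable_sum) auto
  have h_V: "h (V \<omega>) = sample_mean N X \<omega>" for \<omega>
    by (simp add: h_def V_def sample_mean_def)
  have h_translate: "h (diag_translate ?I u x) = h x + u" for u x
    unfolding h_def by (rule sample_mean_diag_translate[OF N])
  have \<phi> [measurable]: "\<phi> \<in> ?P \<rightarrow>\<^sub>M ?P"
    unfolding \<phi>_def[abs_def] by measurable
  have \<phi>_translate: "\<phi> (diag_translate ?I u x) = \<phi> x" for u x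
    unfolding \<phi>_def h_translate diag_translate_translate by simp
  have \<phi>_V: "(\<lambda>i\<in>?I. fluctuation N X i \<omega>) = \<phi> (V \<omega>)" for \<omega>
    unfolding \<phi>_def h_V by (auto simp: fun_eq_iff V_def diag_translate_def fluctuation_def)
  have \<phi>V_F: "(\<lambda>\<omega>. \<phi> (V \<omega>)) \<in> ?F \<rightarrow>\<^sub>M ?P"
    unfolding \<phi>_V[symmetric] by (intro measurable_restrict measurable_fluctuation)
  have sets_F: "sets ?F = {(\<lambda>\<omega>. \<phi> (V \<omega>)) -` B \<inter> space M | B. B \<in> sets ?P}"
    unfolding fluctuation_algebra_eq_vimage_algebra \<phi>_V
    by (subst sets_vimage_algebra2) (use measurable_space[OF V] measurable_space[OF \<phi>] in auto)
  have space_F: "space ?F = space M"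
    unfolding fluctuation_algebra_def by (intro space_measure_of) auto
  have sub: "subalgebra M ?F"
    unfolding subalgebra_def space_F sets_F
    using measurable_sets[OF measurable_compose[OF V \<phi>]] by blast
  define L where "L \<omega> = enn2real (diag_length ?I C (V \<omega>))" for \<omega>
  have L_ennreal: "ennreal (L \<omega>) = diag_length ?I C (V \<omega>)" for \<omega>
    unfolding L_def using bound[of "V \<omega>"] by (intro ennreal_enn2real) (auto simp: less_top[symmetric] top_unique)
  have "AE \<omega> in M. \<forall>s>0. L \<omega> * continuity_modulus \<kappa> s \<omega> \<le> s"
  proof (rule AE_mult_continuity_modulus_le[OF M sub \<kappa>])
    show sm: "sample_mean N X \<in> borel_measurable M"
      unfolding h_V[symmetric, abs_def] by measurable
    \<comment> \<open>Section length is constant along a line, so evaluating it at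
      \<open>\<phi> (V \<omega>)\<close> leaves \<open>L\<close> unchanged and exhibits it as a
      function of the fluctuations.\<close>
    have "(\<lambda>\<omega>. enn2real (diag_length ?I C (\<phi> (V \<omega>)))) \<in> borel_measurable ?F"
      using \<phi>V_F by measurable
    moreover have "enn2real (diag_length ?I C (\<phi> (V \<omega>))) = L \<omega>" for \<omega>
      unfolding L_def \<phi>_def
      by (subst diag_length_translate[OF C]) (auto simp: V_def space_PiM)
    ultimately show "L \<in> borel_measurable ?F" by simp
    show L_nonneg: "0 \<le> L \<omega>" for \<omega> by (simp add: L_def)
    show "L \<omega> \<le> K" for \<omega>
      unfolding L_def by (rule enn2real_leI[OF K bound])
    fix p q :: real and A assume pq: "p \<le> q" and A: "A \<in> sets ?F"
    have [measurable]: "L \<in> borel_measurable M"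
      unfolding L_def[abs_def] by measurable
    have A_M [measurable]: "A \<in> sets M" using A sub by (auto simp: subalgebra_def)
    from A obtain B where B [measurable]: "B \<in> sets ?P" and A_eq: "A = (\<lambda>\<omega>. \<phi> (V \<omega>)) -` B \<inter> space M"
      unfolding sets_F by auto
    \<comment> \<open>The indicator of the event \<open>A\<close>, moved to the coordinate space; it
      is invariant under translation because \<open>\<phi>\<close> is.\<close>
    define f where "f x = (indicator B (\<phi> x) :: ennreal)" for x
    have f [measurable]: "f \<in> borel_measurable ?P"
      unfolding f_def[abs_def] by measurable
    have f_translate: "f (diag_translate ?I u x) = f x" for u x
      by (simp only: f_def \<phi>_translate)
    have f_V: "f (V \<omega>) = indicator A \<omega>" if "\<omega> \<in> space M" for \<omega>
      using that by (auto simp: f_def A_eq indicator_def)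
    have C' [measurable]: "C \<in> sets (PiM ?I (\<lambda>_. lborel))"
      using C by (simp only: sets_PiM_lborel)
    \<comment> \<open>Expectations become normalised integrals over \<open>C\<close>. Both sides of
      the section inequality carry the same normalising constant, so the inequality passes back to
      expectations.\<close>
    have transfer: "(\<integral>\<^sup>+\<omega>. g (V \<omega>) \<partial>M) = (\<integral>\<^sup>+x. g x * indicator C x \<partial>PiM ?I (\<lambda>_. lborel))
        / emeasure (PiM ?I (\<lambda>_. lborel)) C" if g [measurable]: "g \<in> borel_measurable ?P" for g
    proof -
      have "(\<integral>\<^sup>+\<omega>. g (V \<omega>) \<partial>M) = (\<integral>\<^sup>+x. g x \<partial>distr M ?P V)"
        by (rule nn_integral_distr[OF V, symmetric]) measurable
      also have "\<dots> = (\<integral>\<^sup>+x. g x * indicator C x \<partial>PiM ?I (\<lambda>_. lborel))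
        / emeasure (PiM ?I (\<lambda>_. lborel)) C"
        unfolding D by (intro nn_integral_uniform_measure) measurable
      finally show ?thesis .
    qed
    have "(\<integral>\<^sup>+\<omega>. ennreal (indicator A \<omega> * (L \<omega> * indicator {p..q} (sample_mean N X \<omega>))) \<partial>M)
        = (\<integral>\<^sup>+\<omega>. f (V \<omega>) * indicator {p..q} (h (V \<omega>)) * diag_length ?I C (V \<omega>) \<partial>M)"
      by (intro nn_integral_cong) (auto simp: f_V h_V L_ennreal indicator_def)
    also have "\<dots> = (\<integral>\<^sup>+x. f x * indicator {p..q} (h x) * diag_length ?I C x * indicator C x
        \<partial>PiM ?I (\<lambda>_. lborel)) / emeasure (PiM ?I (\<lambda>_. lborel)) C"
      by (rule transfer) measurable
    also have "\<dots> \<le> ennreal (q - p) * (\<integral>\<^sup>+x. f x * indicator C x \<partial>PiM ?I (\<lambda>_. lborel))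
        / emeasure (PiM ?I (\<lambda>_. lborel)) C"
      by (intro divide_right_mono_ennreal nn_integral_diag_length_le pq C f h f_translate h_translate) simp
    also have "\<dots> = ennreal (q - p) * (\<integral>\<^sup>+\<omega>. f (V \<omega>) \<partial>M)"
      by (simp only: transfer[OF f] ennreal_times_divide)
    also have "(\<integral>\<^sup>+\<omega>. f (V \<omega>) \<partial>M) = (\<integral>\<^sup>+\<omega>. indicator A \<omega> \<partial>M)"
      by (intro nn_integral_cong f_V)
    also have "\<dots> = ennreal (measure M A)"
      by (simp add: emeasure_eq_measure)
    finally have "(\<integral>\<^sup>+\<omega>. ennreal (indicator A \<omega> * (L \<omega> * indicator {p..q} (sample_mean N X \<omega>))) \<partial>M)
        \<le> ennreal ((q - p) * measure M A)"
      using pq by (simp add: ennreal_mult)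
    moreover have "(\<lambda>\<omega>. indicator A \<omega> * (L \<omega> * indicator {p..q} (sample_mean N X \<omega>))) \<in> borel_measurable M"
      using sm by measurable
    moreover have "0 \<le> (q - p) * measure M A"
      using pq by simp
    ultimately show "(\<integral>\<omega>\<in>A. L \<omega> * indicator {p..q} (sample_mean N X \<omega>) \<partial>M) \<le> (q - p) * measure M A"
      unfolding set_lebesgue_integral_def real_scaleR_def
      by (subst integral_eq_nn_integral) (auto intro: enn2real_leI simp: L_nonneg)
  qed
  then show ?thesis by (simp add: L_def)
qed

section \<open>Uniform variables on intervals and the union bound\<close>

theorem theorem4p1:
  fixes M :: "'a measure" and N :: nat and l :: real and a :: "nat \<Rightarrow> real"
    and X :: "nat \<Rightarrow> 'a \<Rightarrow> real" and \<kappa> :: "'a \<Rightarrow> real measure"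
  assumes "prob_space M"
    and "N \<ge> 2"
    and "l > 0"
    and "prob_space.indep_vars M (\<lambda>_. borel) X {1..N}"
    and "\<And>i. i \<in> {1..N} \<Longrightarrow> distr M borel (X i) = uniform_measure lborel {a i..a i + l}"
    and "regular_cond_distribution M (fluctuation_algebra M N X) (sample_mean N X) \<kappa>"
  shows "(\<forall>s>0. \<forall>\<delta>\<in>{0<..l}.
            measure M {\<omega> \<in> space M. continuity_modulus \<kappa> s \<omega> \<ge> s / \<delta>} \<le> real N * \<delta> / l)
       \<and> (\<forall>\<alpha>. \<forall>s>0. s powr \<alpha> \<le> l \<longrightarrow>
            measure M {\<omega> \<in> space M. continuity_modulus \<kappa> s \<omega> \<ge> s powr (1 - \<alpha>)}
              \<le> real N / l * s powr \<alpha>)"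
proof -
  let ?I = "{1..N}"
  let ?P = "PiM ?I (\<lambda>_. borel :: real measure)" and ?C = "\<Pi>\<^sub>E i\<in>?I. {a i..a i + l}"
  let ?V = "\<lambda>\<omega>. \<lambda>i\<in>?I. X i \<omega>"
  let ?L = "\<lambda>\<omega>. diag_length ?I ?C (?V \<omega>)"
  interpret prob_space M by fact
  interpret product_sigma_finite "\<lambda>_. lborel :: real measure" ..
  have X: "X i \<in> borel_measurable M" if "i \<in> ?I" for i
    using assms(4) that by (auto simp: indep_vars_def)
  have V: "?V \<in> M \<rightarrow>\<^sub>M ?P"
    using X by (intro measurable_restrict) auto
  have C: "?C \<in> sets ?P"
    by (intro sets_PiM_I_finite) auto
  have "distr M ?P ?V = PiM ?I (\<lambda>i. distr M borel (X i))"
    using assms(2,4) X by (subst indep_vars_iff_distr_eq_PiM'[symmetric]) auto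
  also have "\<dots> = PiM ?I (\<lambda>i. uniform_measure lborel {a i..a i + l})"
    using assms(5) by (intro PiM_cong) auto
  also have "\<dots> = uniform_measure (PiM ?I (\<lambda>_. lborel)) ?C"
    using assms(3) by (intro PiM_uniform_measure) auto
  finally have D: "distr M ?P ?V = uniform_measure (PiM ?I (\<lambda>_. lborel)) ?C" .
  have bound: "diag_length ?I ?C x \<le> ennreal l" for x
    by (rule diag_length_box_le[of 1]) (use assms(2,3) in auto)
  have modulus: "AE \<omega> in M. \<forall>s>0. enn2real (?L \<omega>) * continuity_modulus \<kappa> s \<omega> \<le> s"
    by (rule AE_uniform_continuity_modulus_le[OF assms(1) _ C _ bound X D assms(6)]) (use assms(2,3) in auto)
  \<comment> \<open>The lower bound on section lengths applies to points of the box only; the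
    uniform law puts \<open>?V\<close> there almost surely.\<close>
  have "AE x in distr M ?P ?V. x \<in> ?C"
    unfolding D using C by (intro AE_uniform_measureI) (auto simp only: sets_PiM_lborel)
  then have in_C: "AE \<omega> in M. ?V \<omega> \<in> ?C"
    by (rule AE_distrD[OF V])
  have main: "measure M {\<omega> \<in> space M. continuity_modulus \<kappa> s \<omega> \<ge> s / \<delta>} \<le> real N * \<delta> / l"
    if s: "0 < s" and \<delta>: "0 < \<delta>" "\<delta> \<le> l" for s \<delta>
  proof -
    \<comment> \<open>The non-strict inequality makes the complement yield the strict gap
      \<open>a i + \<delta> < X i \<omega>\<close>.\<close>
    let ?E = "\<lambda>i. {\<omega> \<in> space M. X i \<omega> \<le> a i + \<delta>}"
    have E: "?E i \<in> sets M" if "i \<in> ?I" for i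
      using X[OF that] by measurable
    have "measure M {\<omega> \<in> space M. continuity_modulus \<kappa> s \<omega> \<ge> s / \<delta>} \<le> measure M (\<Union>i\<in>?I. ?E i)"
    proof (rule finite_measure_mono_AE)
      show "AE \<omega> in M. \<omega> \<in> {\<omega> \<in> space M. continuity_modulus \<kappa> s \<omega> \<ge> s / \<delta>} \<longrightarrow> \<omega> \<in> (\<Union>i\<in>?I. ?E i)"
        using modulus in_C
      proof eventually_elim
        case (elim \<omega>)
        show ?case
        proof (intro impI, rule ccontr)
          assume \<omega>: "\<omega> \<in> {\<omega> \<in> space M. continuity_modulus \<kappa> s \<omega> \<ge> s / \<delta>}" "\<omega> \<notin> (\<Union>i\<in>?I. ?E i)"
          then have "a i + \<delta> < X i \<omega>" if "i \<in> ?I" for i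
            using that unfolding not_le[symmetric] by blast
          then have "ennreal \<delta> < ?L \<omega>"
            by (intro diag_length_box_gt[OF _ _ \<delta>(1) elim(2)]) (use assms(2) in auto)
          moreover have "ennreal (enn2real (?L \<omega>)) = ?L \<omega>"
            using bound[of "?V \<omega>"] by (intro ennreal_enn2real) (auto simp: less_top[symmetric] top_unique)
          ultimately have "ennreal \<delta> < ennreal (enn2real (?L \<omega>))"
            by (simp only:)
          then have "\<delta> < enn2real (?L \<omega>)"
            using \<delta>(1) by (subst (asm) ennreal_less_iff) auto
          moreover have "0 < s / \<delta>" using s \<delta> by simp
          \<comment> \<open>The left side equals \<open>s\<close>, whereas the almost sure bound on
            the modulus forces the right side to be at most \<open>s\<close>.\<close>
          ultimately have "\<delta> * (s / \<delta>) < enn2real (?L \<omega>) * (s / \<delta>)"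
            by (intro mult_strict_right_mono)
          also have "\<dots> \<le> enn2real (?L \<omega>) * continuity_modulus \<kappa> s \<omega>"
            using \<omega> by (intro mult_left_mono) auto
          also have "\<dots> \<le> s" using elim(1) s by blast
          finally show False using \<delta> by simp
        qed
      qed
      show "(\<Union>i\<in>?I. ?E i) \<in> sets M" using E by auto
    qed
    also have "\<dots> \<le> (\<Sum>i\<in>?I. measure M (?E i))"
      using E by (intro finite_measure_subadditive_finite) auto
    also have "\<dots> = (\<Sum>i\<in>?I. \<delta> / l)"
    proof (intro sum.cong refl)
      fix i assume i: "i \<in> ?I"
      have "measure M (?E i) = measure (distr M borel (X i)) {..a i + \<delta>}"
        using X[OF i] by (subst measure_distr) (auto intro!: arg_cong[where f = "measure M"])
      also have "\<dots> = measure lborel ({a i..a i + l} \<inter> {..a i + \<delta>}) / measure lborel {a i..a i + l}"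
        unfolding assms(5)[OF i] using assms(3) by (subst measure_uniform_measure) auto
      \<comment> \<open>Here \<open>\<delta> \<le> l\<close> enters: the truncated interval stays
        within the side, so its share is exactly \<open>\<delta> / l\<close>.\<close>
      also have "{a i..a i + l} \<inter> {..a i + \<delta>} = {a i..a i + \<delta>}"
        using \<delta> by auto
      finally show "measure M (?E i) = \<delta> / l"
        using \<delta> by simp
    qed
    finally show ?thesis by simp
  qed
  show ?thesis
  proof (intro conjI allI impI ballI)
    fix s \<delta> :: real assume "0 < s" "\<delta> \<in> {0<..l}"
    then show "measure M {\<omega> \<in> space M. continuity_modulus \<kappa> s \<omega> \<ge> s / \<delta>} \<le> real N * \<delta> / l"
      by (intro main) auto
  next
    \<comment> \<open>Taking \<open>s powr \<alpha>\<close> for \<open>\<delta>\<close>, the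
      threshold \<open>s / \<delta>\<close> becomes \<open>s powr (1 - \<alpha>)\<close>, as
      \<open>s\<close> is positive.\<close>
    fix \<alpha> s :: real assume "0 < s" "s powr \<alpha> \<le> l"
    then show "measure M {\<omega> \<in> space M. continuity_modulus \<kappa> s \<omega> \<ge> s powr (1 - \<alpha>)}
        \<le> real N / l * s powr \<alpha>"
      using main[of s "s powr \<alpha>"] by (simp add: powr_diff)
  qed
qed

end
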